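(* Let $(\beta_n)_{n=1}^\infty$ be any sequence of real numbers with $\beta_n>1$ for all $n$. Let $D$ be the set of points $x\in[0,1]$ such that for every $n\ge1$ and every nonempty finite word $y_1\dots y_m$ occurring in $S_{\beta_n}$, writing $d(x,\beta_n)=(x_k)_{k=0}^\infty$, the quantity \[ \frac{\#\{\, i\in\{0,\dots,N-1\} : x_i\dots x_{i+m-1}=y_1\dots y_m \,\}}{N} \] does not converge as $N\to\infty$. Then $D$ has Hausdorff dimension $1$.
   Context: For $\beta>1$ let $f_\beta(x)=\beta x \pmod 1$ and, for $x\in[0,1]$, let $d(x,\beta)=(d(x,\beta)_n)_{n=0}^\infty$ with $d(x,\beta)_n=[\beta f_\beta^n(x)]$, where $[\cdot]$ is the integer part; this is the expansion of $x$ in base $\beta$. The $\beta$-shift $S_\beta$ is the closure, in the product topology on sequences of non-negative integer digits, of $\{d(x,\beta): x\in[0,1)\}$. A finite word occurs in $S_\beta$ if it appears as a block of consecutive digits in some sequence of $S_\beta$. *)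

theory Defs
  imports "HOL-Analysis.Analysis"
begin

definition beta_map :: "real \<Rightarrow> real \<Rightarrow> real" where
  "beta_map \<beta> x = frac (\<beta> * x)"

text \<open>For \<open>\<beta> > 1\<close> and \<open>x\<close> in \<open>[0, 1]\<close> the floor below is non-negative, so the conversion with
  \<open>nat\<close> loses nothing. Note that the orbit starts at \<open>x\<close> itself, so the leading digit
  of \<open>1\<close> is the floor of \<open>\<beta>\<close>.\<close>

definition beta_expansion :: "real \<Rightarrow> real \<Rightarrow> nat \<Rightarrow> nat" where
  "beta_expansion \<beta> x n = nat \<lfloor>\<beta> * (beta_map \<beta> ^^ n) x\<rfloor>"

text \<open>The closure is taken in the type \<open>nat \<Rightarrow> nat\<close>, whose topology is the product topology
  of the discrete topology on the digits.\<close>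

definition beta_shift :: "real \<Rightarrow> (nat \<Rightarrow> nat) set" where
  "beta_shift \<beta> = closure (beta_expansion \<beta> ` {0..<1})"

definition occurs_at :: "'a list \<Rightarrow> (nat \<Rightarrow> 'a) \<Rightarrow> nat \<Rightarrow> bool" where
  "occurs_at w s i \<longleftrightarrow> map s [i..<i + length w] = w"

definition occurs_in :: "'a list \<Rightarrow> (nat \<Rightarrow> 'a) set \<Rightarrow> bool" where
  "occurs_in w S \<longleftrightarrow> (\<exists>s\<in>S. \<exists>i. occurs_at w s i)"

definition word_freq :: "'a list \<Rightarrow> (nat \<Rightarrow> 'a) \<Rightarrow> nat \<Rightarrow> real" where
  "word_freq w s N = real (card {i \<in> {0..<N}. occurs_at w s i}) / real N"

text \<open>The contribution of one covering set to the \<open>s\<close>-dimensional Hausdorff measure. The case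
  distinction makes the zero-dimensional measure the counting measure, since \<open>0 powr 0 = 0\<close>
  in HOL. Only meaningful for bounded sets, as \<^const>\<open>diameter\<close> is real-valued.\<close>

definition hausdorff_gauge :: "real \<Rightarrow> 'a::metric_space set \<Rightarrow> ennreal" where
  "hausdorff_gauge s U =
     (if U = {} then 0 else if s = 0 then 1 else ennreal (diameter U powr s))"

definition hausdorff_premeasure :: "real \<Rightarrow> real \<Rightarrow> 'a::metric_space set \<Rightarrow> ennreal" where
  "hausdorff_premeasure s \<delta> A =
     (INF U \<in> {U :: nat \<Rightarrow> 'a set.
                 A \<subseteq> (\<Union>i. U i) \<and> (\<forall>i. bounded (U i) \<and> diameter (U i) \<le> \<delta>)}.
        \<Sum>i. hausdorff_gauge s (U i))"

definition hausdorff_measure :: "real \<Rightarrow> 'a::metric_space set \<Rightarrow> ennreal" where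
  "hausdorff_measure s A = (SUP \<delta>\<in>{0<..}. hausdorff_premeasure s \<delta> A)"

definition hausdorff_dim :: "'a::metric_space set \<Rightarrow> ennreal" where
  "hausdorff_dim A = (INF s\<in>{s. 0 \<le> s \<and> hausdorff_measure s A = 0}. ennreal s)"

end

theory Submission
  imports Defs "HOL-Real_Asymp.Real_Asymp"
begin

text \<open>
  Fix \<open>t < 1\<close>. It suffices to find inside the set \<open>D\<close> of the theorem a set of positive
  \<open>t\<close>-dimensional measure; that the dimension is at most 1 is clear.

  \<^emph>\<open>What spoils convergence.\<close> Suppose that the frequency of \<open>w\<close> in the \<open>\<beta>\<close>-expansion of \<open>x\<close>
  converges to \<open>L\<close>. Then along windows from \<open>N\<close> to about \<open>N (1 + 1 / R)\<close>, with \<open>R\<close> fixed and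
  \<open>N\<close> growing, the frequency inside the window also tends to \<open>L\<close>
  (\<open>run_frequency_le_limit\<close>). Hence \<open>L\<close> cannot exist if there are arbitrarily late windows
  filled with the digit 0, and also arbitrarily late windows filled with repetitions of
  one fixed block on which the occurrence of \<open>w\<close> is opposite to that in a row of zeros
  (\<open>not_convergent_word_freq\<close>). No equidistribution of the expansion of \<open>x\<close> is involved.

  \<^emph>\<open>These windows are cheap.\<close> The points with such a window at some \<open>N \<ge> j\<close> contain an interval
  of length about \<open>\<beta>\<close> to the power \<open>- N (1 + 1 / R)\<close> within distance \<open>r = 2 (N + 1) \<beta>\<^sup>-\<^sup>N\<close> of each
  point of the unit interval. This rests on \<open>full_branch_near\<close>: the full cylinders of order \<open>N\<close>,
  after which any admissible digits may follow, are \<open>r\<close>-dense.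
  If \<open>t (1 + 1 / R) < 1\<close>, the \<open>t\<close>-th power of the length of the interval is much larger than \<open>r\<close>; a set with this
  property at arbitrarily small scales is called \<open>t\<close>-ubiquitous below.

  \<^emph>\<open>Countable intersections of \<open>t\<close>-ubiquitous sets are large.\<close> Given balls of radii \<open>d\<^sub>i\<close> with
  \<open>\<Sum> d\<^sub>i\<^sup>t \<le> 1/64\<close>, a nested sequence of intervals is chosen, the \<open>k\<close>-th step inside the \<open>k\<close>-th set,
  such that the balls meeting an interval of length \<open>L\<close> always have total weight
  \<open>\<Sum> d\<^sub>i\<^sup>t\<close> at most \<open>L\<^sup>t/64\<close>. The constant does not deteriorate from one step to the next
  (\<open>light_subinterval\<close>), so the limit point lies in every set and outside every
  ball. Therefore no cover of the intersection has small \<open>t\<close>-dimensional weight. As this works for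
  countably many sets at once, all bases and all words are treated simultaneously.
\<close>

section \<open>Countable intersections of ubiquitous sets\<close>

text \<open>The intervals contained in \<open>V\<close> are so long, compared with their spacing \<open>r\<close>, that their
  \<open>t\<close>-dimensional weight \<open>l powr t / r\<close> per unit length exceeds any prescribed \<open>K\<close>.\<close>
definition ubiquitous :: "real \<Rightarrow> real set \<Rightarrow> bool" where
  "ubiquitous t V \<longleftrightarrow>
     (\<forall>K>0. \<exists>r>0. \<exists>l>0. K * r \<le> 1 \<and> K * r \<le> l powr t \<and>
        (\<forall>x\<in>{0<..<1}. \<exists>v. x - r \<le> v \<and> v + l \<le> x + r \<and> {v..v + l} \<subseteq> V))"

definition hits :: "(nat \<Rightarrow> real) \<Rightarrow> (nat \<Rightarrow> real) \<Rightarrow> real \<Rightarrow> real \<Rightarrow> nat set" where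
  "hits a d u L = {i. \<exists>y\<in>{u..u + L}. \<bar>y - a i\<bar> \<le> d i}"

text \<open>The balls with centres \<open>a i\<close> and radii \<open>d i\<close> that meet the interval weigh little in proportion
  to its length. Finite partial sums avoid any summability side condition. The constant
  64 leaves room for the count in \<open>light_subinterval\<close>.\<close>
definition light :: "real \<Rightarrow> (nat \<Rightarrow> real) \<Rightarrow> (nat \<Rightarrow> real) \<Rightarrow> real \<Rightarrow> real \<Rightarrow> bool" where
  "light t a d u L \<longleftrightarrow>
     (\<forall>F. finite F \<and> F \<subseteq> hits a d u L \<longrightarrow> (\<Sum>i\<in>F. d i powr t) \<le> L powr t / 64)"

lemma card_nat_interval_le:
  fixes \<alpha> h :: real
  assumes "h \<ge> 0"
  shows "finite {j::nat. \<alpha> \<le> j \<and> j \<le> \<alpha> + h}" "real (card {j::nat. \<alpha> \<le> j \<and> j \<le> \<alpha> + h}) \<le> h + 1"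
proof -
  let ?S = "{j::nat. \<alpha> \<le> j \<and> j \<le> \<alpha> + h}"
  have sub: "int ` ?S \<subseteq> {\<lceil>\<alpha>\<rceil>..\<lfloor>\<alpha> + h\<rfloor>}"
    by (auto simp: ceiling_le_iff le_floor_iff)
  then have "finite (int ` ?S)" by (rule finite_subset) simp
  then show fin: "finite ?S" by (rule finite_imageD) simp
  have "card ?S = card (int ` ?S)" by (simp add: card_image)
  also have "\<dots> \<le> card {\<lceil>\<alpha>\<rceil>..\<lfloor>\<alpha> + h\<rfloor>}" using sub by (intro card_mono) auto
  also have "\<dots> = nat (\<lfloor>\<alpha> + h\<rfloor> - \<lceil>\<alpha>\<rceil> + 1)" by simp
  finally have "real (card ?S) \<le> real (nat (\<lfloor>\<alpha> + h\<rfloor> - \<lceil>\<alpha>\<rceil> + 1))" by linarith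
  also have "\<dots> \<le> h + 1" using assms by linarith
  finally show "real (card ?S) \<le> h + 1" .
qed

lemma light_radius_le:
  assumes "0 < t" "light t a d u L" "i \<in> hits a d u L" "0 < L"
  shows "d i \<le> L"
proof (rule ccontr)
  assume "\<not> d i \<le> L"
  then have "L powr t \<le> d i powr t" using assms by (intro powr_mono2) auto
  moreover have "(\<Sum>j\<in>{i}. d j powr t) \<le> L powr t / 64"
    using assms(2,3) unfolding light_def by blast
  moreover have "L powr t > 0" using assms by simp
  ultimately show False by simp
qed

text \<open>The inductive step. Take about \<open>L / (4 r)\<close> evenly spaced intervals of length \<open>l\<close> in \<open>V\<close> and
  count those that are not light. A ball of radius \<open>d \<ge> r\<close> meets at most \<open>2 d / r\<close> of them; since
  \<open>d \<le> L\<close>, this is at most \<open>2 L\<^sup>1\<^sup>-\<^sup>t d\<^sup>t / r\<close>, so lightness of the large interval lets such balls spoil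
  only a small proportion. A ball of radius less than \<open>r\<close> meets only one of
  them, so the intervals overloaded by small balls alone use up disjoint portions of the
  available weight; there are at most \<open>(L / l)\<^sup>t\<close> of those, again a small proportion because
  \<open>V\<close> is ubiquitous and \<open>r\<close> may be chosen after \<open>L\<close>.\<close>
lemma light_subinterval:
  assumes t: "0 < t" "t < 1" and d: "\<And>i. d i > 0" and V: "ubiquitous t V"
    and light: "light t a d u L" and L: "L > 0" "0 \<le> u" "u + L \<le> 1"
  shows "\<exists>v l. 0 < l \<and> l \<le> L / 2 \<and> u \<le> v \<and> v + l \<le> u + L \<and> {v..v + l} \<subseteq> V \<and> light t a d v l"
proof -
  \<comment> \<open>The first summand makes \<open>r\<close> small against \<open>L\<close>; the second bounds the number of
     intervals overloaded by small balls.\<close>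
  define K where "K = 4 / L + 16 * L powr (t - 1)"
  have "K > 0" using L by (simp add: K_def add_pos_nonneg)
  then obtain r l where r: "r > 0" and l: "l > 0" and Kr: "K * r \<le> 1" "K * r \<le> l powr t"
    and near: "\<And>x. x \<in> {0<..<1} \<Longrightarrow> \<exists>v. x - r \<le> v \<and> v + l \<le> x + r \<and> {v..v + l} \<subseteq> V"
    using V unfolding ubiquitous_def by meson
  have "4 / L * r \<le> K * r" using r unfolding K_def by (intro mult_right_mono) auto
  then have "4 / L * r \<le> 1" using Kr by linarith
  then have rL: "4 * r \<le> L" using L by (simp add: field_simps)
  have "16 * L powr (t - 1) * r \<le> K * r" using r L unfolding K_def by (intro mult_right_mono) auto
  then have "16 * L powr (t - 1) * r \<le> l powr t" using Kr by simp
  then have lt: "16 * L powr t * r \<le> l powr t * L"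
    using L by (simp add: powr_diff field_simps)
  define M where "M = nat \<lfloor>L / (4 * r)\<rfloor>"
  have M1: "L / (8 * r) \<le> M"
  proof -
    have "z / 2 \<le> real (nat \<lfloor>z\<rfloor>)" if "z \<ge> 1" for z :: real
    proof -
      have "1 \<le> nat \<lfloor>z\<rfloor>" using that by (simp add: le_nat_floor)
      moreover have "z < real (nat \<lfloor>z\<rfloor>) + 1" using that by linarith
      ultimately show ?thesis by linarith
    qed
    from this[of "L / (4 * r)"] show ?thesis using rL r unfolding M_def by simp
  qed
  define x where "x j = u + r + 4 * r * real j" for j
  have x_in: "u + r \<le> x j \<and> x j + r \<le> u + L" if "j < M" for j
  proof -
    have "real j + 1 \<le> z" if "j < nat \<lfloor>z\<rfloor>" for z :: real
      using that by linarith
    from this[of "L / (4 * r)"] have "real j + 1 \<le> L / (4 * r)" using that unfolding M_def by simp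
    then have "4 * r * (real j + 1) \<le> L" using r by (simp add: field_simps)
    then show ?thesis unfolding x_def using r by (simp add: algebra_simps)
  qed
  have "\<forall>j. \<exists>v. j < M \<longrightarrow> x j - r \<le> v \<and> v + l \<le> x j + r \<and> {v..v + l} \<subseteq> V"
  proof safe
    fix j
    show "\<exists>v. j < M \<longrightarrow> x j - r \<le> v \<and> v + l \<le> x j + r \<and> {v..v + l} \<subseteq> V"
    proof (cases "j < M")
      case True
      then have "x j \<in> {0<..<1}" using x_in[of j] r L by auto
      then show ?thesis using near by blast
    qed auto
  qed
  then obtain v where v: "\<And>j. j < M \<Longrightarrow> x j - r \<le> v j" "\<And>j. j < M \<Longrightarrow> v j + l \<le> x j + r"
      "\<And>j. j < M \<Longrightarrow> {v j..v j + l} \<subseteq> V" by metis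
  have "\<exists>j<M. light t a d (v j) l"
  proof (rule ccontr)
    assume "\<not> ?thesis"
    then have "\<forall>j. \<exists>F. j < M \<longrightarrow> finite F \<and> F \<subseteq> hits a d (v j) l \<and> (\<Sum>i\<in>F. d i powr t) > l powr t / 64"
      unfolding light_def by (meson not_le)
    then obtain F where F: "\<And>j. j < M \<Longrightarrow> finite (F j)" "\<And>j. j < M \<Longrightarrow> F j \<subseteq> hits a d (v j) l"
       "\<And>j. j < M \<Longrightarrow> (\<Sum>i\<in>F j. d i powr t) > l powr t / 64" by metis
    define G where "G = (\<Union>j<M. F j)"
    have Gfin: "finite G" unfolding G_def using F(1) by auto
    have hits_sub: "hits a d (v j) l \<subseteq> hits a d u L" if "j < M" for j
      unfolding hits_def using x_in[OF that] v(1,2)[OF that] by fastforce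
    have Gsub: "G \<subseteq> hits a d u L" unfolding G_def using F(2) hits_sub by blast
    have Gsum: "(\<Sum>i\<in>G. d i powr t) \<le> L powr t / 64"
      using light Gfin Gsub unfolding light_def by blast
    have dist: "\<bar>x j - a i\<bar> \<le> d i + r" if "j < M" "i \<in> F j" for i j
      using F(2)[OF that(1)] that(2) v(1,2)[OF that(1)] unfolding hits_def by fastforce
    \<comment> \<open>\<open>A\<close> collects the intervals spoilt with the help of a large ball, \<open>B\<close> those spoilt by small
       balls alone.\<close>
    define A where "A = {j. j < M \<and> (\<exists>i\<in>F j. d i \<ge> r)}"
    define B where "B = {j. j < M \<and> (\<forall>i\<in>F j. d i < r)}"
    have AB: "{..<M} = A \<union> B" unfolding A_def B_def by (auto, meson linorder_not_less)
    have finAB: "finite A" "finite B" unfolding A_def B_def by auto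
    have cardA: "real (card A) \<le> L / (32 * r)"
    proof -
      \<comment> \<open>\<open>N i\<close> contains every \<open>j\<close> with \<open>x j\<close> at distance at most \<open>2 d i\<close> from \<open>a i\<close>.\<close>
      define N where "N i = {j. (a i - 2 * d i - u - r) / (4 * r) \<le> real j \<and>
          real j \<le> (a i - 2 * d i - u - r) / (4 * r) + d i / r}" for i
      have finN: "finite (N i)" and cN: "real (card (N i)) \<le> d i / r + 1" for i
        unfolding N_def using card_nat_interval_le[of "d i / r"] d[of i] r
        by (auto intro: less_imp_le)
      have "A \<subseteq> (\<Union>i\<in>{i\<in>G. d i \<ge> r}. N i)"
      proof
        fix j assume "j \<in> A"
        then obtain i where i: "j < M" "i \<in> F j" "d i \<ge> r" unfolding A_def by blast
        then have "\<bar>x j - a i\<bar> \<le> 2 * d i" using dist[of j i] by linarith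
        then have "j \<in> N i" unfolding N_def x_def using r
          by (auto simp: field_simps abs_le_iff)
        then show "j \<in> (\<Union>i\<in>{i\<in>G. d i \<ge> r}. N i)" using i unfolding G_def by blast
      qed
      then have "card A \<le> card (\<Union>i\<in>{i\<in>G. d i \<ge> r}. N i)"
        using Gfin finN by (intro card_mono) auto
      also have "\<dots> \<le> (\<Sum>i\<in>{i\<in>G. d i \<ge> r}. card (N i))"
        using Gfin by (intro card_UN_le) auto
      finally have "real (card A) \<le> (\<Sum>i\<in>{i\<in>G. d i \<ge> r}. real (card (N i)))"
        by (metis of_nat_le_iff of_nat_sum)
      also have "\<dots> \<le> (\<Sum>i\<in>{i\<in>G. d i \<ge> r}. 2 * L powr (1 - t) / r * d i powr t)"
      proof (rule sum_mono)
        fix i assume i: "i \<in> {i\<in>G. d i \<ge> r}"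
        have "d i \<le> L" using light_radius_le[OF t(1) light _ L(1)] i Gsub by blast
        then have "d i powr t * d i powr (1 - t) \<le> d i powr t * L powr (1 - t)"
          using t d[of i] by (intro mult_left_mono powr_mono2) (auto intro: less_imp_le)
        then have di: "d i \<le> d i powr t * L powr (1 - t)"
          using d[of i] by (simp flip: powr_add)
        have "real (card (N i)) \<le> 2 * d i / r" using cN[of i] i r by (simp add: field_simps)
        also have "\<dots> \<le> 2 * (d i powr t * L powr (1 - t)) / r"
          using di r by (simp add: divide_right_mono)
        finally show "real (card (N i)) \<le> 2 * L powr (1 - t) / r * d i powr t"
          by (simp add: mult_ac)
      qed
      also have "\<dots> \<le> 2 * L powr (1 - t) / r * (\<Sum>i\<in>G. d i powr t)"
        unfolding sum_distrib_left[symmetric] using Gfin r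
        by (intro mult_left_mono sum_mono2) auto
      also have "\<dots> \<le> 2 * L powr (1 - t) / r * (L powr t / 64)"
        using Gsum r by (intro mult_left_mono) auto
      also have "\<dots> = (L powr (1 - t) * L powr t) / (32 * r)" by simp
      also have "\<dots> = L / (32 * r)" using L by (simp flip: powr_add)
      finally show ?thesis .
    qed
    have cardB: "real (card B) \<le> L / (16 * r)"
    proof -
      have disj: "F j \<inter> F j' = {}" if "j \<in> B" "j' \<in> B" "j \<noteq> j'" for j j'
      proof (rule ccontr)
        assume "F j \<inter> F j' \<noteq> {}"
        then obtain i where i: "i \<in> F j" "i \<in> F j'" by blast
        then have "d i < r" using that unfolding B_def by blast
        then have "\<bar>x j - x j'\<bar> < 4 * r"
          using dist[of j i] dist[of j' i] i that unfolding B_def by force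
        moreover have "\<bar>x j - x j'\<bar> = 4 * r * \<bar>real j - real j'\<bar>"
          unfolding x_def using r by (simp add: abs_mult flip: right_diff_distrib)
        moreover have "\<bar>real j - real j'\<bar> \<ge> 1" using that(3) by linarith
        ultimately show False using r
          by (smt (verit) mult_le_cancel_left1)
      qed
      have "real (card B) * (l powr t / 64) = (\<Sum>j\<in>B. l powr t / 64)" by simp
      also have "\<dots> \<le> (\<Sum>j\<in>B. \<Sum>i\<in>F j. d i powr t)"
        by (intro sum_mono less_imp_le F(3)) (auto simp: B_def)
      also have "\<dots> = (\<Sum>i\<in>(\<Union>j\<in>B. F j). d i powr t)"
        using finAB disj F(1) by (subst sum.UNION_disjoint) (auto simp: B_def)
      also have "\<dots> \<le> (\<Sum>i\<in>G. d i powr t)"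
        using Gfin by (intro sum_mono2) (auto simp: B_def G_def)
      finally have "real (card B) * l powr t \<le> L powr t" using Gsum by simp
      then have "16 * r * (real (card B) * l powr t) \<le> 16 * r * L powr t"
        using r by (intro mult_left_mono) auto
      also have "\<dots> \<le> l powr t * L" using lt by (simp add: mult_ac)
      finally have "l powr t * (real (card B) * (16 * r)) \<le> l powr t * L" by (simp add: mult_ac)
      then have "real (card B) * (16 * r) \<le> L" using l by simp
      then show ?thesis using r by (simp add: field_simps)
    qed
    have "real M \<le> real (card A) + real (card B)"
      using card_Un_le[of A B] AB by (metis card_lessThan of_nat_add of_nat_le_iff)
    then have "L / (8 * r) \<le> L / (32 * r) + L / (16 * r)" using M1 cardA cardB by linarith
    then show False using L r by (simp add: field_simps)
  qed
  then obtain j where j: "j < M" "light t a d (v j) l" by blast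
  show ?thesis
    using j v[OF j(1)] x_in[OF j(1)] l rL by (intro exI[of _ "v j"] exI[of _ l]) auto
qed

text \<open>Iterating the step gives nested light intervals shrinking to a point. A ball containing
  that point would meet all of them, but the radius of a ball that meets a light interval is
  at most the length of the interval.\<close>
lemma ubiquitous_INT_escapes:
  fixes V :: "nat \<Rightarrow> real set" and a d :: "nat \<Rightarrow> real"
  assumes t: "0 < t" "t < 1" and d: "\<And>i. d i > 0" and V: "\<And>k. ubiquitous t (V k)"
    and sum: "\<And>F. finite F \<Longrightarrow> (\<Sum>i\<in>F. d i powr t) \<le> 1 / 64"
  shows "\<exists>x\<in>{0..1}. (\<forall>k. x \<in> V k) \<and> (\<forall>i. \<bar>x - a i\<bar> > d i)"
proof -
  define P where "P = (\<lambda>(k::nat) (u, L). 0 < L \<and> 0 \<le> u \<and> u + L \<le> 1 \<and> light t a d u L)"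
  define Q where "Q = (\<lambda>k (u, L) (v, l). l \<le> L / 2 \<and> u \<le> v \<and> v + l \<le> u + L \<and> {v..v + l} \<subseteq> V k)"
  have "\<exists>f. \<forall>k. P k (f k) \<and> Q k (f k) (f (Suc k))"
  proof (rule dependent_nat_choice)
    show "\<exists>x. P 0 x"
      using sum by (intro exI[of _ "(0, 1)"]) (auto simp: P_def light_def)
  next
    fix I and k :: nat assume "P k I"
    then obtain u L where I: "I = (u, L)" "0 < L" "0 \<le> u" "u + L \<le> 1" "light t a d u L"
      unfolding P_def by (cases I) auto
    then obtain v l where "0 < l \<and> l \<le> L / 2 \<and> u \<le> v \<and> v + l \<le> u + L \<and> {v..v + l} \<subseteq> V k \<and> light t a d v l"
      using light_subinterval[where a = a and d = d and u = u and L = L, OF t d V[of k]] by blast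
    then have "P (Suc k) (v, l) \<and> Q k I (v, l)"
      using I unfolding P_def Q_def by auto
    then show "\<exists>y. P (Suc k) y \<and> Q k I y" by blast
  qed
  then obtain f where f: "\<And>k. P k (f k)" "\<And>k. Q k (f k) (f (Suc k))" by blast
  define u L where "u k = fst (f k)" and "L k = snd (f k)" for k
  have fuL: "f k = (u k, L k)" for k unfolding u_def L_def by simp
  have P: "0 < L k" "0 \<le> u k" "u k + L k \<le> 1" "light t a d (u k) (L k)" for k
    using f(1)[of k] unfolding fuL P_def by auto
  have Q: "L (Suc k) \<le> L k / 2" "u k \<le> u (Suc k)" "u (Suc k) + L (Suc k) \<le> u k + L k"
    "{u (Suc k)..u (Suc k) + L (Suc k)} \<subseteq> V k" for k
    using f(2)[of k] unfolding fuL Q_def by auto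
  have "(\<Inter>k. {u k..u k + L k}) \<noteq> {}"
  proof (rule compact_nest)
    show "{u n..u n + L n} \<subseteq> {u m..u m + L m}" if "m \<le> n" for m n
      using that by (rule lift_Suc_antimono_le[of "\<lambda>n. {u n..u n + L n}", rotated])
        (use Q(2,3) in auto)
    show "{u n..u n + L n} \<noteq> {}" for n using P(1)[of n] by auto
  qed auto
  then obtain x where x: "\<And>k. x \<in> {u k..u k + L k}" by blast
  have "x \<in> V k" for k using Q(4)[of k] x[of "Suc k"] by blast
  moreover have "x \<in> {0..1}" using x[of 0] P(2,3)[of 0] by auto
  moreover have "\<bar>x - a i\<bar> > d i" for i
  proof (rule ccontr)
    assume "\<not> ?thesis"
    then have "i \<in> hits a d (u k) (L k)" for k
      using x[of k] unfolding hits_def by (auto intro!: bexI[of _ x])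
    then have le: "d i \<le> L k" for k using light_radius_le[OF t(1) P(4) _ P(1)] by blast
    have Lk: "L k \<le> L 0 * (1 / 2) ^ k" for k
    proof (induction k)
      case (Suc k) then show ?case using Q(1)[of k] by simp
    qed simp
    have "(\<lambda>k. L 0 * (1 / 2) ^ k) \<longlonglongrightarrow> L 0 * 0"
      by (intro tendsto_intros LIMSEQ_realpow_zero) auto
    then have "d i \<le> 0"
      using le Lk by (intro LIMSEQ_le_const[of "\<lambda>k. L 0 * (1 / 2) ^ k" 0]) (auto intro: order_trans)
    then show False using d[of i] by simp
  qed
  ultimately show ?thesis by blast
qed

section \<open>Hausdorff measure and dimension on the line\<close>

text \<open>A cover of small weight is turned into balls with positive radii of small weight, which
  then miss a point of the intersection.\<close>
lemma hausdorff_measure_ubiquitous_INT: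
  fixes V :: "'i::countable \<Rightarrow> real set"
  assumes t: "0 < t" "t < 1" and V: "\<And>k. ubiquitous t (V k)" and D: "{0..1} \<inter> (\<Inter>k. V k) \<subseteq> D"
  shows "hausdorff_measure t D \<noteq> 0"
proof
  assume "hausdorff_measure t D = 0"
  then have "hausdorff_premeasure t 1 D = 0"
    unfolding hausdorff_measure_def by (metis SUP_upper greaterThan_iff le_zero_eq zero_less_one)
  then have "(INF U \<in> {U :: nat \<Rightarrow> real set.
                 D \<subseteq> (\<Union>i. U i) \<and> (\<forall>i. bounded (U i) \<and> diameter (U i) \<le> 1)}.
        \<Sum>i. hausdorff_gauge t (U i)) < ennreal (1 / 128)"
    unfolding hausdorff_premeasure_def by simp
  then obtain U :: "nat \<Rightarrow> real set" where U: "D \<subseteq> (\<Union>i. U i)" "\<And>i. bounded (U i)"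
    and small: "(\<Sum>i. hausdorff_gauge t (U i)) < ennreal (1 / 128)"
    unfolding INF_less_iff by auto
  define a where "a i = (SOME y. y \<in> U i)" for i
  \<comment> \<open>A covering set of diameter 0 needs a positive radius; the added terms sum to \<open>1/128\<close>.\<close>
  define d where "d i = (diameter (U i) powr t + (1 / 2) ^ (i + 8)) powr (1 / t)" for i
  have dpowr: "d i powr t = diameter (U i) powr t + (1 / 2) ^ (i + 8)" for i
    unfolding d_def using t by (simp add: powr_powr add_nonneg_nonneg)
  have dpos: "d i > 0" for i
    unfolding d_def by (simp add: add_nonneg_pos less_imp_neq[THEN not_sym])
  have dge: "diameter (U i) \<le> d i" for i
  proof -
    have "diameter (U i) = (diameter (U i) powr t) powr (1 / t)"
      using t U(2)[of i] by (simp add: powr_powr diameter_ge_0)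
    also have "\<dots> \<le> d i" unfolding d_def using t by (intro powr_mono2) auto
    finally show ?thesis .
  qed
  have gauge: "ennreal (diameter (U i) powr t) = hausdorff_gauge t (U i)" for i
    unfolding hausdorff_gauge_def using t by (auto simp: diameter_def)
  have sumF: "(\<Sum>i\<in>F. d i powr t) \<le> 1 / 64" if F: "finite F" for F
  proof -
    have "ennreal (\<Sum>i\<in>F. diameter (U i) powr t) = (\<Sum>i\<in>F. hausdorff_gauge t (U i))"
      by (simp add: gauge flip: sum_ennreal)
    also have "\<dots> \<le> (\<Sum>i. hausdorff_gauge t (U i))"
      using F by (intro sum_le_suminf) auto
    also note small
    finally have 1: "(\<Sum>i\<in>F. diameter (U i) powr t) \<le> 1 / 128" by (simp add: ennreal_less_iff sum_nonneg)
    have s: "(\<lambda>i. (1 / 2 :: real) ^ (i + 8)) sums (1 / 128)"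
      using sums_mult2[OF geometric_sums[of "1 / 2 :: real"], of "(1 / 2) ^ 8"]
      by (simp add: power_add power_divide)
    have "(\<Sum>i\<in>F. (1 / 2 :: real) ^ (i + 8)) \<le> (\<Sum>i. (1 / 2) ^ (i + 8))"
      using F s by (intro sum_le_suminf) (auto simp: sums_iff)
    then have 2: "(\<Sum>i\<in>F. (1 / 2 :: real) ^ (i + 8)) \<le> 1 / 128" using s by (simp add: sums_iff)
    show ?thesis using 1 2 unfolding dpowr sum.distrib by linarith
  qed
  obtain x where x: "x \<in> {0..1}" "\<And>k. x \<in> V (from_nat k)" "\<And>i. \<bar>x - a i\<bar> > d i"
    using ubiquitous_INT_escapes[where V = "\<lambda>k. V (from_nat k)" and a = a and d = d, OF t dpos V]
      sumF by blast
  have "x \<in> V i" for i using x(2)[of "to_nat i"] by simp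
  then have "x \<in> D" using D x(1) by blast
  then obtain i where i: "x \<in> U i" using U(1) by blast
  then have "a i \<in> U i" unfolding a_def by (rule someI)
  then have "\<bar>x - a i\<bar> \<le> diameter (U i)"
    using diameter_bounded_bound[OF U(2)[of i] i] by (simp add: dist_real_def)
  then show False using x(3)[of i] dge[of i] by linarith
qed

text \<open>For \<open>s > 1\<close>, the \<open>n\<close> intervals of length \<open>1/n\<close> have total weight \<open>n\<^sup>1\<^sup>-\<^sup>s\<close>, which tends to 0.\<close>
lemma hausdorff_measure_unit_interval_eq_0:
  assumes s: "s > 1" and D: "D \<subseteq> {0..1::real}"
  shows "hausdorff_measure s D = 0"
proof -
  have "hausdorff_premeasure s \<delta> D = 0" if \<delta>: "\<delta> > 0" for \<delta>
  proof -
    have bound: "hausdorff_premeasure s \<delta> D \<le> ennreal (real n powr (1 - s))"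
      if n: "n > 0" "1 / real n \<le> \<delta>" for n
    proof -
      define U where "U i = (if i < n then {real i / n..real (Suc i) / n} else {})" for i
      have diam: "diameter (U i) = (if i < n then 1 / n else 0)" for i
        unfolding U_def using n by (simp add: field_simps)
      have "D \<subseteq> (\<Union>i. U i)"
      proof
        fix x assume "x \<in> D"
        then have x: "0 \<le> x" "x \<le> 1" using D by auto
        show "x \<in> (\<Union>i. U i)"
        proof (cases "x = 1")
          case True
          then have "x \<in> U (n - 1)" unfolding U_def using n by auto
          then show ?thesis by blast
        next
          case False
          define i where "i = nat \<lfloor>x * n\<rfloor>"
          have xn: "0 \<le> x * n" "x * n < n" using x n False by auto
          then have "real i \<le> x * n" "x * n \<le> real (Suc i)" "i < n"
            unfolding i_def by linarith+
          then have "x \<in> U i" unfolding U_def using n by (simp add: field_simps)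
          then show ?thesis by blast
        qed
      qed
      moreover have "bounded (U i) \<and> diameter (U i) \<le> \<delta>" for i
        using n \<delta> unfolding diam by (auto simp: U_def)
      ultimately have "hausdorff_premeasure s \<delta> D \<le> (\<Sum>i. hausdorff_gauge s (U i))"
        unfolding hausdorff_premeasure_def by (intro INF_lower) auto
      also have "\<dots> = (\<Sum>i<n. hausdorff_gauge s (U i))"
        by (rule suminf_finite) (auto simp: hausdorff_gauge_def U_def)
      also have "\<dots> \<le> (\<Sum>i<n. ennreal ((1 / n) powr s))"
        using s by (intro sum_mono) (auto simp: hausdorff_gauge_def diam)
      also have "\<dots> = ennreal (n * (1 / n) powr s)"
        by (simp add: ennreal_mult ennreal_of_nat_eq_real_of_nat)
      also have "n * (1 / n) powr s = real n powr (1 - s)"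
        using n by (simp add: powr_diff powr_divide)
      finally show ?thesis .
    qed
    have "(\<lambda>n. ennreal (real n powr (1 - s))) \<longlonglongrightarrow> ennreal 0"
      using s by (intro tendsto_ennrealI) real_asymp
    moreover have "\<forall>\<^sub>F n in sequentially. 0 < n \<and> 1 / real n \<le> \<delta>"
    proof -
      have "(\<lambda>n. 1 / real n) \<longlonglongrightarrow> 0" by real_asymp
      then have "\<forall>\<^sub>F n in sequentially. 1 / real n < \<delta>" using \<delta> by (rule order_tendstoD)
      then show ?thesis using eventually_gt_at_top[of 0] by eventually_elim auto
    qed
    then have "\<forall>\<^sub>F n in sequentially. hausdorff_premeasure s \<delta> D \<le> ennreal (real n powr (1 - s))"
      by eventually_elim (use bound in auto)
    ultimately have "hausdorff_premeasure s \<delta> D \<le> ennreal 0"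
      by (intro tendsto_lowerbound) auto
    then show ?thesis by simp
  qed
  then show ?thesis unfolding hausdorff_measure_def by (simp add: SUP_eq_const)
qed

lemma hausdorff_dim_eq_1I:
  assumes D: "D \<subseteq> {0..1::real}" and pos: "\<And>t. 0 < t \<Longrightarrow> t < 1 \<Longrightarrow> hausdorff_measure t D \<noteq> 0"
  shows "hausdorff_dim D = 1"
proof (rule antisym)
  have "hausdorff_dim D \<le> ennreal (1 + 1 / real (Suc n))" for n
    unfolding hausdorff_dim_def using hausdorff_measure_unit_interval_eq_0[OF _ D]
    by (intro INF_lower) auto
  moreover have "(\<lambda>n. ennreal (1 + 1 / real (Suc n))) \<longlonglongrightarrow> ennreal 1"
    by (intro tendsto_ennrealI) real_asymp
  ultimately show "hausdorff_dim D \<le> 1"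
    by (intro tendsto_lowerbound[of "\<lambda>n. ennreal (1 + 1 / real (Suc n))" 1 sequentially]) auto
next
  have ne: "D \<noteq> {}"
  proof
    assume "D = {}"
    moreover have "hausdorff_premeasure (1/2) \<delta> ({}::real set) = 0" if "\<delta> > 0" for \<delta>
    proof -
      have "hausdorff_premeasure (1/2) \<delta> ({}::real set) \<le> (\<Sum>i::nat. hausdorff_gauge (1/2) ({}::real set))"
        unfolding hausdorff_premeasure_def using that by (intro INF_lower) auto
      then show ?thesis by (simp add: hausdorff_gauge_def)
    qed
    ultimately have "hausdorff_measure (1/2) D = 0"
      unfolding hausdorff_measure_def by (simp add: SUP_eq_const)
    then show False using pos[of "1/2"] by simp
  qed
  have "1 \<le> s" if s: "0 \<le> s" "hausdorff_measure s D = 0" for s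
  proof (rule ccontr)
    assume "\<not> 1 \<le> s"
    \<comment> \<open>Exponent 0 is outside the range of \<open>pos\<close>, but its gauge counts the nonempty
       covering sets.\<close>
    then have "s = 0" using s pos[of s] by force
    have "hausdorff_premeasure s 1 D = 0"
      using s unfolding hausdorff_measure_def by (metis SUP_upper greaterThan_iff le_zero_eq zero_less_one)
    then have "(INF U \<in> {U :: nat \<Rightarrow> real set.
                 D \<subseteq> (\<Union>i. U i) \<and> (\<forall>i. bounded (U i) \<and> diameter (U i) \<le> 1)}.
        \<Sum>i. hausdorff_gauge s (U i)) < 1"
      unfolding hausdorff_premeasure_def by simp
    then obtain U :: "nat \<Rightarrow> real set" where U: "D \<subseteq> (\<Union>i. U i)" "(\<Sum>i. hausdorff_gauge s (U i)) < 1"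
      unfolding INF_less_iff by auto
    obtain i where "U i \<noteq> {}" using U(1) ne by blast
    then have "1 = sum (\<lambda>i. hausdorff_gauge s (U i)) {i}"
      by (simp add: hausdorff_gauge_def \<open>s = 0\<close>)
    also have "\<dots> \<le> (\<Sum>i. hausdorff_gauge s (U i))" by (intro sum_le_suminf) auto
    finally show False using U(2) by simp
  qed
  then show "1 \<le> hausdorff_dim D"
    unfolding hausdorff_dim_def by (intro INF_greatest) (auto simp flip: ennreal_1 intro: ennreal_leI)
qed

section \<open>Full cylinders of beta-transformations\<close>

context
  fixes \<beta> :: real
  assumes \<beta>: "\<beta> > 1"
begin

abbreviation "T \<equiv> beta_map \<beta>"

text \<open>The map \<open>y \<mapsto> b + y / \<beta> ^ N\<close> is an inverse branch of the \<open>N\<close>-th iterate on the whole of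
  \<open>[0, 1)\<close>. Equivalently, \<open>b\<close> is the left endpoint of a cylinder of order \<open>N\<close> that the iterate maps
  onto \<open>[0, 1)\<close>, so its first \<open>N\<close> digits may be followed by the expansion of any point.\<close>
definition full_branch :: "nat \<Rightarrow> real \<Rightarrow> bool" where
  "full_branch N b \<longleftrightarrow>
     (\<forall>y\<in>{0..<1}. b + y / \<beta> ^ N \<in> {0..<1} \<and> (T ^^ N) (b + y / \<beta> ^ N) = y)"

text \<open>The left endpoint of the cylinder of order \<open>N\<close> that contains \<open>x\<close>.\<close>
definition left_end :: "nat \<Rightarrow> real \<Rightarrow> real" where
  "left_end N x = x - (T ^^ N) x / \<beta> ^ N"

lemma iterate_range: "x \<in> {0..<1} \<Longrightarrow> (T ^^ n) x \<in> {0..<1}"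
  by (cases n) (auto simp: beta_map_def frac_lt_1)

lemma digit_eq:
  assumes "x \<in> {0..<1}"
  shows "real (beta_expansion \<beta> x n) = \<beta> * (T ^^ n) x - (T ^^ Suc n) x"
proof -
  have "0 \<le> \<beta> * (T ^^ n) x" using iterate_range[OF assms, of n] \<beta> by simp
  then show ?thesis by (simp add: beta_expansion_def beta_map_def frac_def)
qed

lemma left_end_0 [simp]: "left_end 0 x = 0"
  by (simp add: left_end_def)

lemma left_end_Suc:
  assumes "x \<in> {0..<1}"
  shows "left_end (Suc N) x = left_end N x + real (beta_expansion \<beta> x N) / \<beta> ^ Suc N"
proof -
  have "x - v / (\<beta> * p) = x - u / p + (\<beta> * u - v) / (\<beta> * p)" if "p \<noteq> 0" for u v p
    using that \<beta> by (simp add: field_simps)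
  from this[of "\<beta> ^ N"] show ?thesis
    using \<beta> unfolding left_end_def digit_eq[OF assms] power_Suc by simp
qed

lemma left_end_mono: "x \<in> {0..<1} \<Longrightarrow> i \<le> m \<Longrightarrow> left_end i x \<le> left_end m x"
  using \<beta> by (elim lift_Suc_mono_le[of "\<lambda>i. left_end i x", rotated]) (simp add: left_end_Suc)

lemma left_end_bounds:
  assumes "x \<in> {0..<1}"
  shows "0 \<le> left_end N x" "left_end N x \<le> x" "x \<le> left_end N x + 1 / \<beta> ^ N"
  using left_end_mono[OF assms, of 0 N] iterate_range[OF assms, of N] \<beta>
  by (auto simp: left_end_def divide_right_mono)

text \<open>As long as the affine continuation of the iterates from \<open>x\<close> stays in \<open>[0, 1)\<close>, no carry
  occurs, so \<open>z\<close> lies in the same cylinder as \<open>x\<close>.\<close>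
lemma iterate_affine:
  assumes x: "x \<in> {0..<1}"
    and z: "\<And>i. i \<le> m \<Longrightarrow> (T ^^ i) x + \<beta> ^ i * (z - x) \<in> {0..<1}"
  shows "i \<le> m \<Longrightarrow> (T ^^ i) z = (T ^^ i) x + \<beta> ^ i * (z - x)"
proof (induction i)
  case (Suc i)
  then have IH: "(T ^^ i) z = (T ^^ i) x + \<beta> ^ i * (z - x)" by simp
  have "(T ^^ Suc i) z = frac (\<beta> * (T ^^ i) x + \<beta> ^ Suc i * (z - x))"
    by (simp add: beta_map_def IH algebra_simps)
  also have "\<beta> * (T ^^ i) x = real (beta_expansion \<beta> x i) + (T ^^ Suc i) x"
    using digit_eq[OF x, of i] by simp
  finally have "(T ^^ Suc i) z
      = frac (((T ^^ Suc i) x + \<beta> ^ Suc i * (z - x)) + of_int (int (beta_expansion \<beta> x i)))"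
    by (simp add: algebra_simps del: funpow.simps)
  also have "\<dots> = (T ^^ Suc i) x + \<beta> ^ Suc i * (z - x)"
    using z[OF Suc.prems] by (simp add: frac_unique_iff del: funpow.simps)
  finally show ?case .
qed simp

lemma same_digits:
  assumes x: "x \<in> {0..<1}"
    and z: "\<And>i. i \<le> m \<Longrightarrow> (T ^^ i) x + \<beta> ^ i * (z - x) \<in> {0..<1}" and i: "i < m"
  shows "beta_expansion \<beta> z i = beta_expansion \<beta> x i"
proof -
  have "z \<in> {0..<1}" using z[of 0] by simp
  then have "real (beta_expansion \<beta> z i) = \<beta> * (T ^^ i) z - (T ^^ Suc i) z" by (rule digit_eq)
  also have "\<dots> = \<beta> * (T ^^ i) x - (T ^^ Suc i) x"
  proof -
    have "(T ^^ i) z = (T ^^ i) x + \<beta> ^ i * (z - x)"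
      "(T ^^ Suc i) z = (T ^^ Suc i) x + \<beta> ^ Suc i * (z - x)"
      using i by (intro iterate_affine[OF x z, of m]; simp)+
    then show ?thesis by (simp only: power_Suc) (simp add: algebra_simps del: funpow.simps)
  qed
  also have "\<dots> = real (beta_expansion \<beta> x i)" using x by (simp only: digit_eq)
  finally show ?thesis by simp
qed

lemma between_left_end:
  assumes x: "x \<in> {0..<1}" and z: "left_end m x \<le> z" "z \<le> x" and i: "i \<le> m"
  shows "(T ^^ i) x + \<beta> ^ i * (z - x) \<in> {0..<1}"
proof -
  have "left_end i x \<le> z" using left_end_mono[OF x i] z by simp
  then have "0 \<le> \<beta> ^ i * (z - left_end i x)" using \<beta> by simp
  also have "\<dots> = (T ^^ i) x + \<beta> ^ i * (z - x)"
    using \<beta> by (simp add: left_end_def algebra_simps)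
  finally have "0 \<le> (T ^^ i) x + \<beta> ^ i * (z - x)" .
  moreover have "\<beta> ^ i * (z - x) \<le> 0" using z \<beta> by (simp add: mult_nonneg_nonpos)
  ultimately show ?thesis using iterate_range[OF x, of i] by auto
qed

lemma full_branch_append:
  assumes "full_branch N b" "full_branch M c"
  shows "full_branch (N + M) (b + c / \<beta> ^ N)"
  unfolding full_branch_def
proof
  fix y :: real assume y: "y \<in> {0..<1}"
  let ?z = "c + y / \<beta> ^ M"
  have eq: "b + c / \<beta> ^ N + y / \<beta> ^ (N + M) = b + ?z / \<beta> ^ N"
    using \<beta> by (simp add: power_add field_simps)
  have z: "?z \<in> {0..<1}" "(T ^^ M) ?z = y" using assms(2) y unfolding full_branch_def by auto
  then have "b + ?z / \<beta> ^ N \<in> {0..<1}" "(T ^^ N) (b + ?z / \<beta> ^ N) = ?z"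
    using assms(1) unfolding full_branch_def by blast+
  moreover have "(T ^^ (N + M)) (b + ?z / \<beta> ^ N) = (T ^^ M) ((T ^^ N) (b + ?z / \<beta> ^ N))"
    by (simp add: funpow_add add.commute[of N M])
  ultimately show "b + c / \<beta> ^ N + y / \<beta> ^ (N + M) \<in> {0..<1} \<and>
      (T ^^ (N + M)) (b + c / \<beta> ^ N + y / \<beta> ^ (N + M)) = y"
    unfolding eq using z by simp
qed

lemma full_branch_0: "full_branch 0 0"
  by (simp add: full_branch_def)

lemma full_branch_zeros: "full_branch N 0"
proof (induction N)
  case (Suc N)
  have "full_branch 1 0"
    unfolding full_branch_def using \<beta> by (auto simp: beta_map_def frac_eq field_simps)
  from full_branch_append[OF this Suc] show ?case by simp
qed (rule full_branch_0)

text \<open>Lowering a nonzero last digit by one leaves room for any continuation: everything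
  in \<open>[0, 1)\<close> after the lower digit is lexicographically below the word of \<open>x\<close>.\<close>
lemma full_branch_decrement:
  assumes x: "x \<in> {0..<1}" and digit: "beta_expansion \<beta> x N > 0"
  shows "full_branch (Suc N) (left_end (Suc N) x - 1 / \<beta> ^ Suc N)"
  unfolding full_branch_def
proof
  fix y :: real assume y: "y \<in> {0..<1}"
  let ?d = "real (beta_expansion \<beta> x N)"
  define z where "z = left_end (Suc N) x - 1 / \<beta> ^ Suc N + y / \<beta> ^ Suc N"
  have z_eq: "z = left_end N x + (?d - 1 + y) / \<beta> ^ Suc N"
    unfolding z_def left_end_Suc[OF x] by (simp add: add_divide_distrib diff_divide_distrib)
  have d1: "?d \<ge> 1" using digit by simp
  have zl: "left_end N x \<le> z" unfolding z_eq using d1 y \<beta> by simp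
  have "y / \<beta> ^ Suc N \<le> 1 / \<beta> ^ Suc N" using y \<beta> by (intro divide_right_mono) auto
  then have zx: "z \<le> x" using left_end_bounds(2)[OF x, of "Suc N"] unfolding z_def by linarith
  have "z \<in> {0..<1}" using zl zx left_end_bounds(1)[OF x, of N] x by auto
  moreover have "(T ^^ Suc N) z = y"
  proof -
    have "(T ^^ N) z = (T ^^ N) x + \<beta> ^ N * (z - x)"
      using between_left_end[OF x zl zx] by (intro iterate_affine[OF x, of N]) auto
    also have "\<dots> = \<beta> ^ N * (z - left_end N x)"
      using \<beta> by (simp add: left_end_def algebra_simps)
    also have "\<dots> = (?d - 1 + y) / \<beta>" unfolding z_eq using \<beta> by simp
    finally have "(T ^^ Suc N) z = frac (?d - 1 + y)" using \<beta> by (simp add: beta_map_def)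
    also have "\<dots> = y" using y by (simp add: frac_unique_iff)
    finally show ?thesis .
  qed
  ultimately show "left_end (Suc N) x - 1 / \<beta> ^ Suc N + y / \<beta> ^ Suc N \<in> {0..<1} \<and>
      (T ^^ Suc N) (left_end (Suc N) x - 1 / \<beta> ^ Suc N + y / \<beta> ^ Suc N) = y"
    unfolding z_def by blast
qed

lemma left_end_last_nonzero:
  assumes "x \<in> {0..<1}"
  shows "left_end N x = 0 \<or>
    (\<exists>j<N. left_end N x = left_end (Suc j) x \<and> beta_expansion \<beta> x j > 0)"
proof (induction N)
  case (Suc N)
  then show ?case
    by (cases "beta_expansion \<beta> x N = 0") (auto simp: left_end_Suc[OF assms] less_Suc_eq)
qed simp

text \<open>If the first \<open>N\<close> digits of \<open>x\<close> are all 0, then \<open>b = 0\<close> works. Otherwise lower the last nonzero one,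
  at position \<open>j\<close>; this gives a full cylinder of order \<open>Suc j\<close> that ends where the cylinder of
  \<open>x\<close> begins. Inside it, close to its right end, the induction hypothesis supplies a full
  cylinder of order \<open>N\<close>. Each such descent costs at most two lengths \<open>1 / \<beta> ^ N\<close>, and there are
  at most \<open>N\<close> of them.\<close>
lemma full_branch_near:
  "x \<in> {0..<1} \<Longrightarrow> \<exists>b. full_branch N b \<and> b \<le> x \<and> x \<le> b + 2 * (real N + 1) / \<beta> ^ N"
proof (induction N arbitrary: x rule: less_induct)
  case (less N)
  note x = less.prems
  from left_end_last_nonzero[OF x, of N] show ?case
  proof
    assume "left_end N x = 0"
    then have "x \<le> 1 / \<beta> ^ N" using left_end_bounds(3)[OF x, of N] by simp
    also have "\<dots> \<le> 2 * (real N + 1) / \<beta> ^ N" using \<beta> by (intro divide_right_mono) auto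
    finally show ?thesis using full_branch_zeros x by (intro exI[of _ 0]) auto
  next
    assume "\<exists>j<N. left_end N x = left_end (Suc j) x \<and> beta_expansion \<beta> x j > 0"
    then obtain j where j: "j < N" "left_end N x = left_end (Suc j) x" "beta_expansion \<beta> x j > 0"
      by blast
    define M where "M = N - Suc j"
    have N: "N = Suc j + M" using j unfolding M_def by simp
    let ?u = "left_end (Suc j) x - 1 / \<beta> ^ Suc j"
    have "1 - 1 / \<beta> ^ M \<in> {0..<1}" using \<beta> by simp
    moreover have "M < N" using N by simp
    ultimately obtain b where b: "full_branch M b" "b \<le> 1 - 1 / \<beta> ^ M"
        "1 - 1 / \<beta> ^ M \<le> b + 2 * (real M + 1) / \<beta> ^ M"
      using less.IH by blast
    have "full_branch N (?u + b / \<beta> ^ Suc j)"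
      unfolding N using full_branch_append[OF full_branch_decrement[OF x j(3)] b(1)] .
    moreover have "?u + b / \<beta> ^ Suc j \<le> x"
    proof -
      have "b \<le> 1" using b(2) \<beta> by (smt (verit) divide_nonneg_nonneg zero_le_power)
      then have "b / \<beta> ^ Suc j \<le> 1 / \<beta> ^ Suc j" using \<beta> by (intro divide_right_mono) auto
      then show ?thesis using left_end_bounds(2)[OF x, of "Suc j"] by linarith
    qed
    moreover have "x \<le> ?u + b / \<beta> ^ Suc j + 2 * (real N + 1) / \<beta> ^ N"
    proof -
      have "1 - b \<le> (2 * (real M + 1) + 1) / \<beta> ^ M" using b(3) by (simp add: add_divide_distrib)
      also have "\<dots> \<le> (2 * real N + 1) / \<beta> ^ M" using \<beta> N by (intro divide_right_mono) auto
      finally have "(1 - b) / \<beta> ^ Suc j \<le> (2 * real N + 1) / \<beta> ^ M / \<beta> ^ Suc j"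
        using \<beta> by (intro divide_right_mono) auto
      also have "\<dots> = (2 * real N + 1) / \<beta> ^ N" unfolding N by (simp add: power_add mult_ac)
      finally have "1 / \<beta> ^ Suc j \<le> b / \<beta> ^ Suc j + (2 * real N + 1) / \<beta> ^ N"
        by (simp add: diff_divide_distrib)
      moreover have "x \<le> left_end (Suc j) x + 1 / \<beta> ^ N"
        using left_end_bounds(3)[OF x, of N] j(2) by simp
      moreover have "2 * (real N + 1) / \<beta> ^ N = (2 * real N + 1) / \<beta> ^ N + 1 / \<beta> ^ N"
        by (simp flip: add_divide_distrib)
      ultimately show ?thesis by linarith
    qed
    ultimately show ?thesis by blast
  qed
qed

text \<open>Every word at the start of an expansion becomes full after enough zeros have been appended:
  its cylinder contains an interval to the right of the left endpoint \<open>a\<close>, and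
  appending zeros shrinks the cylinder towards \<open>a\<close>.\<close>
lemma full_branch_with_prefix:
  assumes x: "x \<in> {0..<1}"
  shows "\<exists>q c. q > 0 \<and> full_branch q c \<and>
    (\<forall>z\<in>{c..<c + 1 / \<beta> ^ q}. \<forall>i<m. beta_expansion \<beta> z i = beta_expansion \<beta> x i)"
proof -
  define a where "a = left_end m x"
  have a01: "a \<in> {0..<1}" using left_end_bounds[OF x, of m] x unfolding a_def by auto
  have ax: "(T ^^ i) x + \<beta> ^ i * (a - x) \<in> {0..<1}" if "i \<le> m" for i
    using between_left_end[OF x _ _ that] left_end_bounds(2)[OF x] unfolding a_def by simp
  have Tma: "(T ^^ m) a = 0"
    using iterate_affine[OF x ax, of m m] \<beta> by (simp add: a_def left_end_def)
  have "\<forall>\<^sub>F q in sequentially. \<forall>i\<in>{..m}. (T ^^ i) a + \<beta> ^ i / \<beta> ^ q < 1"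
  proof (rule eventually_ball_finite)
    show "\<forall>i\<in>{..m}. \<forall>\<^sub>F q in sequentially. (T ^^ i) a + \<beta> ^ i / \<beta> ^ q < 1"
    proof
      fix i
      have "(\<lambda>q. (T ^^ i) a + \<beta> ^ i / \<beta> ^ q) \<longlonglongrightarrow> (T ^^ i) a"
        using tendsto_add[OF tendsto_const LIMSEQ_divide_realpow_zero[OF \<beta>]] by simp
      moreover have "(T ^^ i) a < 1" using iterate_range[OF a01, of i] by simp
      ultimately show "\<forall>\<^sub>F q in sequentially. (T ^^ i) a + \<beta> ^ i / \<beta> ^ q < 1"
        by (rule order_tendstoD(2))
    qed
  qed simp
  then have "\<forall>\<^sub>F q in sequentially. (\<forall>i\<in>{..m}. (T ^^ i) a + \<beta> ^ i / \<beta> ^ q < 1) \<and> m < q"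
    using eventually_gt_at_top[of m] by (rule eventually_conj)
  then obtain q where q: "\<And>i. i \<le> m \<Longrightarrow> (T ^^ i) a + \<beta> ^ i / \<beta> ^ q < 1" "m < q"
    unfolding eventually_sequentially by (metis atMost_iff order_refl)
  have za: "(T ^^ i) a + \<beta> ^ i * (z - a) \<in> {0..<1}"
    if z: "z \<in> {a..<a + 1 / \<beta> ^ q}" and "i \<le> m" for z i
  proof -
    have "0 \<le> \<beta> ^ i * (z - a)" using z \<beta> by simp
    moreover have "\<beta> ^ i * (z - a) \<le> \<beta> ^ i * (1 / \<beta> ^ q)"
      using z \<beta> by (intro mult_left_mono) auto
    ultimately show ?thesis using q(1)[OF that(2)] iterate_range[OF a01, of i] by auto
  qed
  have "full_branch q a"
    unfolding full_branch_def
  proof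
    fix y :: real assume y: "y \<in> {0..<1}"
    let ?z = "a + y / \<beta> ^ q"
    have z: "?z \<in> {a..<a + 1 / \<beta> ^ q}" using y \<beta> by (simp add: divide_strict_right_mono)
    have "(T ^^ m) ?z = \<beta> ^ m * (y / \<beta> ^ q)"
      using iterate_affine[OF a01 za[OF z], of m m] Tma by simp
    also have "\<dots> = 0 + y / \<beta> ^ (q - m)"
      using q(2) \<beta> by (simp add: power_diff)
    finally have "(T ^^ (q - m)) ((T ^^ m) ?z) = y"
      using full_branch_zeros[of "q - m"] y unfolding full_branch_def by simp
    then have "(T ^^ q) ?z = y" using q(2) funpow_add[of "q - m" m T] by simp
    then show "?z \<in> {0..<1} \<and> (T ^^ q) ?z = y" using za[OF z, of 0] by simp
  qed
  moreover have "\<forall>z\<in>{a..<a + 1 / \<beta> ^ q}. \<forall>i<m. beta_expansion \<beta> z i = beta_expansion \<beta> x i"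
    using same_digits[OF a01 za] same_digits[OF x ax] by (metis (no_types, lifting))
  ultimately show ?thesis using q(2) by (intro exI[of _ q] exI[of _ a]) auto
qed

lemma full_branch_repeat:
  assumes "full_branch q c"
  shows "\<exists>b. full_branch (l * q) b \<and>
    (\<forall>y\<in>{0..<1}. \<forall>i<l. (T ^^ (i * q)) (b + y / \<beta> ^ (l * q)) \<in> {c..<c + 1 / \<beta> ^ q})"
proof (induction l)
  case 0
  then show ?case using full_branch_0 by auto
next
  case (Suc l)
  then obtain b where b: "full_branch (l * q) b"
    "\<And>y i. y \<in> {0..<1} \<Longrightarrow> i < l \<Longrightarrow> (T ^^ (i * q)) (b + y / \<beta> ^ (l * q)) \<in> {c..<c + 1 / \<beta> ^ q}"
    by blast
  have "(T ^^ (i * q)) (c + b / \<beta> ^ q + y / \<beta> ^ (Suc l * q)) \<in> {c..<c + 1 / \<beta> ^ q}"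
    if y: "y \<in> {0..<1}" and i: "i < Suc l" for y i
  proof -
    let ?w = "b + y / \<beta> ^ (l * q)"
    have eq: "c + b / \<beta> ^ q + y / \<beta> ^ (Suc l * q) = c + ?w / \<beta> ^ q"
      using \<beta> by (simp add: power_add field_simps)
    have w: "?w \<in> {0..<1}" using b(1) y unfolding full_branch_def by blast
    show ?thesis
    proof (cases i)
      case 0
      then show ?thesis unfolding eq using w \<beta> by (simp add: divide_strict_right_mono)
    next
      case (Suc k)
      have "(T ^^ q) (c + ?w / \<beta> ^ q) = ?w" using assms w unfolding full_branch_def by blast
      moreover have "(T ^^ (i * q)) (c + ?w / \<beta> ^ q) = (T ^^ (k * q)) ((T ^^ q) (c + ?w / \<beta> ^ q))"
        unfolding Suc by (simp add: funpow_add add.commute[of q])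
      ultimately show ?thesis unfolding eq using b(2)[OF y, of k] i Suc by simp
    qed
  qed
  moreover have "full_branch (Suc l * q) (c + b / \<beta> ^ q)"
    using full_branch_append[OF assms b(1)] by simp
  ultimately show ?case by blast
qed

text \<open>At some \<open>N \<ge> j\<close> the expansion starts to repeat the block of length \<open>q\<close> that is coded by \<open>c\<close>,
  for about \<open>N / R\<close> digits. The case \<open>q = 1\<close> and \<open>c = 0\<close> is a run of zeros.\<close>
definition block_runs :: "nat \<Rightarrow> nat \<Rightarrow> real \<Rightarrow> nat \<Rightarrow> real set" where
  "block_runs R q c j =
     {x \<in> {0..<1}. \<exists>N\<ge>j. \<forall>i<N div (R * q). (T ^^ (N + i * q)) x \<in> {c..<c + 1 / \<beta> ^ q}}"

text \<open>The repeated block is full, so it can be attached to each of the full cylinders of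
  order \<open>N\<close>. The result is a cylinder of length \<open>1 / \<beta> ^ (N + e)\<close> with \<open>e \<le> N / R\<close>.\<close>
lemma ubiquitous_block_runs:
  assumes t: "0 < t" and R: "t * (1 + 1 / real R) < 1" "R > 0" and c: "full_branch q c"
  shows "ubiquitous t (block_runs R q c j)"
  unfolding ubiquitous_def
proof (intro allI impI)
  fix K :: real assume K: "K > 0"
  \<comment> \<open>\<open>l powr t\<close> beats \<open>1 / \<beta> ^ N\<close> by the exponential factor \<open>g ^ N\<close>, which absorbs the factor
     \<open>N + 1\<close> in \<open>r\<close>.\<close>
  define g where "g = \<beta> powr (1 - t * (1 + 1 / real R))"
  have g: "g > 1" unfolding g_def using \<beta> R by (intro gr_one_powr) auto
  have "(\<lambda>N. K * (2 * (real N + 1) / \<beta> ^ N)) \<longlonglongrightarrow> 0" using \<beta> by real_asymp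
  then have 1: "\<forall>\<^sub>F N in sequentially. K * (2 * (real N + 1) / \<beta> ^ N) < 1"
    by (rule order_tendstoD) simp
  have "(\<lambda>N. 2 powr t * K * (2 * (real N + 1) / g ^ N)) \<longlonglongrightarrow> 0" using g by real_asymp
  then have 2: "\<forall>\<^sub>F N in sequentially. 2 powr t * K * (2 * (real N + 1) / g ^ N) < 1"
    by (rule order_tendstoD) simp
  have "\<exists>N. N \<ge> j \<and> K * (2 * (real N + 1) / \<beta> ^ N) < 1 \<and> 2 powr t * K * (2 * (real N + 1) / g ^ N) < 1"
    using eventually_conj[OF eventually_ge_at_top[of j] eventually_conj[OF 1 2]]
    by (auto simp: eventually_sequentially)
  then obtain N where N: "N \<ge> j" "K * (2 * (real N + 1) / \<beta> ^ N) < 1"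
    "2 powr t * K * (2 * (real N + 1) / g ^ N) < 1" by blast
  define m where "m = N div (R * q)"
  define e where "e = m * q"
  have eN: "real e \<le> real N / R"
  proof -
    have "m * (R * q) \<le> N" unfolding m_def by simp
    then have "real (m * (R * q)) \<le> real N" by (simp only: of_nat_le_iff)
    then show ?thesis using R unfolding e_def by (simp add: field_simps)
  qed
  define r where "r = 2 * (real N + 1) / \<beta> ^ N"
  \<comment> \<open>Half of the cylinder, because cylinders are half-open and a closed interval is wanted.\<close>
  define l where "l = 1 / 2 / \<beta> ^ (N + e)"
  have rpos: "r > 0" and lpos: "l > 0" unfolding r_def l_def using \<beta> by auto
  have Krl: "K * r \<le> l powr t"
  proof -
    have "g ^ N = \<beta> powr (real N - t * (real N * (1 + 1 / R)))"
      unfolding g_def using \<beta> by (simp add: algebra_simps powr_powr flip: powr_realpow)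
    then have gN: "g ^ N = \<beta> ^ N / \<beta> powr (t * (real N * (1 + 1 / R)))"
      using \<beta> by (simp add: powr_diff powr_realpow)
    have "2 powr t * (K * r) * \<beta> powr (t * (real N * (1 + 1 / R))) \<le> 1"
      using N(3) \<beta> unfolding gN r_def by (simp add: field_simps)
    then have "K * r \<le> 1 / (2 powr t * \<beta> powr (t * (real N * (1 + 1 / R))))"
      using \<beta> by (simp add: field_simps)
    also have "\<dots> \<le> 1 / (2 powr t * \<beta> powr (t * real (N + e)))"
      using \<beta> t eN by (intro divide_left_mono mult_left_mono powr_mono) (auto simp: algebra_simps)
    also have "\<beta> powr (t * real (N + e)) = (\<beta> ^ (N + e)) powr t"
      using \<beta> by (simp add: powr_powr mult.commute flip: powr_realpow)
    also have "1 / (2 powr t * (\<beta> ^ (N + e)) powr t) = l powr t"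
      unfolding l_def using \<beta> by (simp add: powr_divide flip: powr_mult)
    finally show ?thesis .
  qed
  obtain b' where b': "full_branch e b'"
    "\<And>y i. y \<in> {0..<1} \<Longrightarrow> i < m \<Longrightarrow> (T ^^ (i * q)) (b' + y / \<beta> ^ e) \<in> {c..<c + 1 / \<beta> ^ q}"
    using full_branch_repeat[OF c, of m] unfolding e_def by blast
  have "\<exists>v. x - r \<le> v \<and> v + l \<le> x + r \<and> {v..v + l} \<subseteq> block_runs R q c j" if x: "x \<in> {0<..<1}" for x
  proof -
    have "x \<in> {0..<1}" using x by auto
    then obtain b where b: "full_branch N b" "b \<le> x" "x \<le> b + r"
      using full_branch_near[of x N] unfolding r_def by blast
    define v where "v = b + b' / \<beta> ^ N"
    have b'0: "0 \<le> b'" using b'(1) unfolding full_branch_def by (auto dest: bspec[of _ _ 0])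
    have "b' + (1 / 2) / \<beta> ^ e < 1"
      using b'(1) unfolding full_branch_def by (auto dest: bspec[of _ _ "1 / 2"])
    then have "(b' + (1 / 2) / \<beta> ^ e) / \<beta> ^ N \<le> 1 / \<beta> ^ N"
      using \<beta> by (intro divide_right_mono) auto
    also have "\<dots> \<le> r" unfolding r_def using \<beta> by (intro divide_right_mono) auto
    finally have "v + l \<le> b + r"
      unfolding v_def l_def by (simp add: add_divide_distrib power_add mult_ac)
    moreover have "b \<le> v" unfolding v_def using b'0 \<beta> by simp
    moreover have "z \<in> block_runs R q c j" if z: "z \<in> {v..v + l}" for z
    proof -
      \<comment> \<open>\<open>y\<close> is the coordinate of \<open>z\<close> in the inverse branch of order \<open>N + e\<close> at \<open>v\<close>.\<close>
      define y where "y = (z - v) * \<beta> ^ (N + e)"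
      have "(z - v) * \<beta> ^ (N + e) \<le> l * \<beta> ^ (N + e)"
        using z \<beta> by (intro mult_right_mono) auto
      then have y: "y \<in> {0..<1}" using z \<beta> unfolding y_def l_def by auto
      let ?w = "b' + y / \<beta> ^ e"
      have w: "?w \<in> {0..<1}" using b'(1) y unfolding full_branch_def by blast
      have zw: "z = b + ?w / \<beta> ^ N"
        unfolding y_def v_def using \<beta> by (simp add: power_add field_simps)
      have "z \<in> {0..<1}" "(T ^^ N) z = ?w"
        using b(1) w unfolding zw full_branch_def by blast+
      moreover have "(T ^^ (N + i * q)) z = (T ^^ (i * q)) ((T ^^ N) z)" for i
        by (simp add: funpow_add add.commute[of N])
      ultimately show ?thesis
        unfolding block_runs_def using N(1) b'(2)[OF y] unfolding m_def by auto
    qed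
    ultimately show ?thesis using b by (intro exI[of _ v]) auto
  qed
  moreover have "K * r \<le> 1" using N(2) unfolding r_def by simp
  ultimately show "\<exists>r>0. \<exists>l>0. K * r \<le> 1 \<and> K * r \<le> l powr t \<and>
        (\<forall>x\<in>{0<..<1}. \<exists>v. x - r \<le> v \<and> v + l \<le> x + r \<and> {v..v + l} \<subseteq> block_runs R q c j)"
    using rpos lpos Krl by blast
qed

end

section \<open>Words in expansions\<close>

lemma closure_fun_agrees:
  fixes S :: "(nat \<Rightarrow> nat) set"
  assumes "s \<in> closure S"
  shows "\<exists>u\<in>S. \<forall>k<n. u k = s k"
proof -
  let ?U = "\<Inter>k\<in>{..<n}. (\<lambda>f::nat \<Rightarrow> nat. f k) -` {s k}"
  have "open ?U"
    by (intro open_INT finite_lessThan ballI open_vimage continuous_on_product_coordinates)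
      (simp add: open_discrete)
  moreover have "s \<in> ?U" by simp
  ultimately have "S \<inter> ?U \<noteq> {}"
    using assms unfolding closure_iff_nhds_not_empty by blast
  then show ?thesis by auto
qed

lemma occurs_at_iff: "occurs_at w s i \<longleftrightarrow> (\<forall>k<length w. s (i + k) = w ! k)"
  unfolding occurs_at_def by (subst list_eq_iff_nth_eq) auto

lemma beta_expansion_shift:
  "beta_expansion \<beta> x (i + k) = beta_expansion \<beta> ((beta_map \<beta> ^^ i) x) k"
  by (simp add: beta_expansion_def add.commute[of i] funpow_add)

lemma occurs_at_shift:
  "occurs_at w (beta_expansion \<beta> x) i \<longleftrightarrow> occurs_at w (beta_expansion \<beta> ((beta_map \<beta> ^^ i) x)) 0"
  by (simp add: occurs_at_iff beta_expansion_shift)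

text \<open>Passing to the closure creates no new words, and a word inside an expansion
  starts the expansion of an iterate.\<close>
lemma occurs_in_beta_shift_prefix:
  assumes \<beta>: "\<beta> > 1" and "occurs_in w (beta_shift \<beta>)"
  shows "\<exists>x\<in>{0..<1}. occurs_at w (beta_expansion \<beta> x) 0"
proof -
  obtain s i where s: "s \<in> closure (beta_expansion \<beta> ` {0..<1})" "occurs_at w s i"
    using assms(2) unfolding occurs_in_def beta_shift_def by blast
  obtain x where x: "x \<in> {0..<1}" "\<forall>k<i + length w. beta_expansion \<beta> x k = s k"
    using closure_fun_agrees[OF s(1), of "i + length w"] by blast
  have "occurs_at w (beta_expansion \<beta> x) i" using s(2) x(2) unfolding occurs_at_iff by auto
  then show ?thesis using iterate_range[OF \<beta> x(1), of i] occurs_at_shift by blast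
qed

text \<open>The occurrence of \<open>w\<close> at \<open>i\<close> is decided oppositely to its occurrence in the zero sequence.
  With this predicate in place of occurrence, words of zeros and other words need no separate
  treatment: it fails on runs of zeros in either case.\<close>
definition departs_from_zeros :: "nat list \<Rightarrow> (nat \<Rightarrow> nat) \<Rightarrow> nat \<Rightarrow> bool" where
  "departs_from_zeros w s i \<longleftrightarrow> (occurs_at w s i \<longleftrightarrow> w \<noteq> replicate (length w) 0)"

lemma not_departs_from_zeros:
  assumes "\<And>k. k < length w \<Longrightarrow> s (i + k) = 0"
  shows "\<not> departs_from_zeros w s i"
  using assms list_eq_iff_nth_eq[of w "replicate (length w) 0"]
  unfolding departs_from_zeros_def occurs_at_iff by auto

text \<open>A word other than a row of zeros can start the block itself. For a row of zeros,
  any block with a nonzero first digit will do, such as one starting like the expansion of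
  \<open>1 / \<beta>\<close>.\<close>
lemma departing_block_exists:
  assumes \<beta>: "\<beta> > 1" and w: "w \<noteq> []" "occurs_in w (beta_shift \<beta>)"
  shows "\<exists>q c. q > 0 \<and> full_branch \<beta> q c \<and>
           (\<forall>z\<in>{c..<c + 1 / \<beta> ^ q}. departs_from_zeros w (beta_expansion \<beta> z) 0)"
proof -
  have "\<exists>x\<in>{0..<1}. departs_from_zeros w (beta_expansion \<beta> x) 0"
  proof (cases "w = replicate (length w) 0")
    case True
    have "beta_expansion \<beta> (1 / \<beta>) 0 = 1" using \<beta> by (simp add: beta_expansion_def)
    then have "\<not> occurs_at w (beta_expansion \<beta> (1 / \<beta>)) 0"
      using w(1) True unfolding occurs_at_iff
      by (metis add.right_neutral length_greater_0_conv nth_replicate zero_neq_one)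
    then show ?thesis
      using \<beta> True unfolding departs_from_zeros_def by (intro bexI[of _ "1 / \<beta>"]) auto
  next
    case False
    then show ?thesis
      using occurs_in_beta_shift_prefix[OF \<beta> w(2)] unfolding departs_from_zeros_def by blast
  qed
  then obtain x where x: "x \<in> {0..<1}" "departs_from_zeros w (beta_expansion \<beta> x) 0" by blast
  obtain q c where qc: "q > 0" "full_branch \<beta> q c"
    "\<And>z i. z \<in> {c..<c + 1 / \<beta> ^ q} \<Longrightarrow> i < length w \<Longrightarrow> beta_expansion \<beta> z i = beta_expansion \<beta> x i"
    using full_branch_with_prefix[OF \<beta> x(1), of "length w"] by blast
  then have "departs_from_zeros w (beta_expansion \<beta> z) 0" if "z \<in> {c..<c + 1 / \<beta> ^ q}" for z
    using x(2) that unfolding departs_from_zeros_def occurs_at_iff by simp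
  then show ?thesis using qc by blast
qed

section \<open>Limiting frequencies and long runs\<close>

text \<open>The window starting at \<open>N\<close> has length \<open>e\<close> comparable to \<open>N\<close>. Both counts, up to \<open>N\<close> and up to
  \<open>N + e\<close>, are within \<open>o(N)\<close> of \<open>L\<close> times the number of positions, hence so is their difference. A
  bounded error \<open>C\<close> in the window allows for occurrences that reach over its end.\<close>
lemma run_frequency_le_limit:
  fixes P :: "nat \<Rightarrow> bool" and \<kappa> C L :: real and R q :: nat
  assumes lim: "(\<lambda>N. real (card {i. i < N \<and> P i}) / real N) \<longlonglongrightarrow> L"
    and Rq: "R > 0" "q > 0"
    and runs: "\<And>j. \<exists>N\<ge>j. \<kappa> * real (N div (R * q) * q) - C
                 \<le> real (card {i. N \<le> i \<and> i < N + N div (R * q) * q \<and> P i})"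
  shows "\<kappa> \<le> L"
proof (rule ccontr)
  assume "\<not> \<kappa> \<le> L"
  define g where "g = \<kappa> - L"
  have g: "g > 0" using \<open>\<not> \<kappa> \<le> L\<close> by (simp add: g_def)
  \<comment> \<open>Up to bounded terms \<open>g e \<ge> g N / R\<close>, whereas the error below is \<open>3 \<delta> N\<close>, half as large.\<close>
  define \<delta> where "\<delta> = g / (6 * R)"
  have \<delta>: "\<delta> > 0" using g Rq by (simp add: \<delta>_def)
  define cnt where "cnt N = real (card {i. i < N \<and> P i})" for N
  obtain N0 where N0: "\<And>N. N \<ge> N0 \<Longrightarrow> \<bar>cnt N / N - L\<bar> < \<delta>"
    using LIMSEQ_D[OF lim \<delta>] unfolding cnt_def by auto
  have cnt: "\<bar>cnt N - L * N\<bar> \<le> \<delta> * N" if "N \<ge> N0" "N > 0" for N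
  proof -
    have "\<bar>cnt N / N - L\<bar> * N \<le> \<delta> * N" using N0[OF that(1)] by (intro mult_right_mono) auto
    moreover have "\<bar>cnt N / N - L\<bar> * N = \<bar>(cnt N / N - L) * N\<bar>" by (simp add: abs_mult)
    moreover have "(cnt N / N - L) * N = cnt N - L * N" using that by (simp add: field_simps)
    ultimately show ?thesis by simp
  qed
  obtain J :: nat where J: "(g * q + C) * (2 * R) / g < J" using reals_Archimedean2 by blast
  obtain N where N: "N \<ge> max (max N0 1) J"
    "\<kappa> * real (N div (R * q) * q) - C \<le> real (card {i. N \<le> i \<and> i < N + N div (R * q) * q \<and> P i})"
    using runs by blast
  define e where "e = N div (R * q) * q"
  have split: "{i. i < N + e \<and> P i} = {i. i < N \<and> P i} \<union> {i. N \<le> i \<and> i < N + e \<and> P i}" by auto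
  have "cnt (N + e) = cnt N + real (card {i. N \<le> i \<and> i < N + e \<and> P i})"
    unfolding cnt_def split by (subst card_Un_disjoint) auto
  then have 1: "\<kappa> * e - C \<le> cnt (N + e) - cnt N" using N(2) unfolding e_def by simp
  have "cnt (N + e) \<le> L * (N + e) + \<delta> * (N + e)" using cnt[of "N + e"] N(1) by (auto simp: abs_le_iff)
  moreover have "L * N - \<delta> * N \<le> cnt N" using cnt[of N] N(1) by (auto simp: abs_le_iff)
  ultimately have 2: "cnt (N + e) - cnt N \<le> L * e + \<delta> * (2 * N + e)"
    by (simp add: algebra_simps)
  have eN: "e \<le> N"
  proof -
    have "e \<le> R * e" using Rq by simp
    also have "R * e \<le> N" unfolding e_def
      using div_times_less_eq_dividend[of N "R * q"] by (simp add: mult_ac)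
    finally show ?thesis .
  qed
  have "g * e \<le> \<delta> * (2 * N + e) + C" using 1 2 unfolding g_def by (simp add: algebra_simps)
  also have "\<dots> \<le> \<delta> * (3 * N) + C" using eN \<delta> by (intro add_right_mono mult_left_mono) auto
  finally have up: "g * e \<le> g * N / (2 * R) + C" unfolding \<delta>_def by (simp add: field_simps)
  have "N < (N div (R * q) + 1) * (R * q)" using Rq
    by (metis Suc_eq_plus1 dividend_less_div_times mult_pos_pos add.commute mult_Suc)
  also have "\<dots> = R * e + R * q" unfolding e_def by (simp add: algebra_simps)
  finally have "real N \<le> R * (real e + real q)"
    by (metis less_imp_le of_nat_add of_nat_le_iff of_nat_mult distrib_left)
  then have "real N / R - q \<le> e" using Rq by (simp add: field_simps)
  then have "g * (real N / R - q) \<le> g * e" using g by (intro mult_left_mono) auto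
  then have "g * N / (2 * R) \<le> g * q + C" using up by (simp add: algebra_simps)
  then have "N \<le> (g * q + C) * (2 * R) / g" using g Rq by (simp add: field_simps)
  then show False using J N(1) by linarith
qed

lemma word_freq_alt: "word_freq w s N = real (card {i. i < N \<and> occurs_at w s i}) / real N"
proof -
  have "{i \<in> {0..<N}. occurs_at w s i} = {i. i < N \<and> occurs_at w s i}" by auto
  then show ?thesis by (simp add: word_freq_def)
qed

lemma card_complement_frequency:
  assumes "(\<lambda>N. real (card {i. i < N \<and> P i}) / real N) \<longlonglongrightarrow> L"
  shows "(\<lambda>N. real (card {i. i < N \<and> \<not> P i}) / real N) \<longlonglongrightarrow> 1 - L"
proof -
  have "real (card {i. i < N \<and> \<not> P i}) / real N = 1 - real (card {i. i < N \<and> P i}) / real N"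
    if "N > 0" for N
  proof -
    have "card {..<N} = card {i. i < N \<and> \<not> P i} + card {i. i < N \<and> P i}"
      by (subst card_Un_disjoint[symmetric]) (auto intro!: arg_cong[where f = card] simp del: card_lessThan)
    then have "real N = real (card {i. i < N \<and> \<not> P i}) + real (card {i. i < N \<and> P i})" by simp
    then show ?thesis using that by (simp add: field_simps)
  qed
  then have "\<forall>\<^sub>F N in sequentially. 1 - real (card {i. i < N \<and> P i}) / real N
      = real (card {i. i < N \<and> \<not> P i}) / real N"
    by (intro eventually_mono[OF eventually_gt_at_top[of 0]]) simp
  moreover have "(\<lambda>N. 1 - real (card {i. i < N \<and> P i}) / real N) \<longlonglongrightarrow> 1 - L"
    using assms by (intro tendsto_intros)
  ultimately show ?thesis by (rule Lim_transform_eventually[rotated])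
qed

text \<open>Zero runs force the limiting frequency of \<open>departs_from_zeros\<close> to be 0, whereas
  block runs force it to be at least \<open>1 / q\<close>.\<close>
lemma not_convergent_word_freq:
  assumes \<beta>: "\<beta> > 1" and R: "R > 0" and q: "q > 0"
    and block: "\<And>z. z \<in> {c..<c + 1 / \<beta> ^ q} \<Longrightarrow> departs_from_zeros w (beta_expansion \<beta> z) 0"
    and zeros_run: "\<And>j. x \<in> block_runs \<beta> R 1 0 j"
    and block_run: "\<And>j. x \<in> block_runs \<beta> R q c j"
  shows "\<not> convergent (word_freq w (beta_expansion \<beta> x))"
proof
  let ?s = "beta_expansion \<beta> x"
  let ?P = "departs_from_zeros w ?s"
  assume "convergent (word_freq w ?s)"
  then obtain L0 where L0: "(\<lambda>N. real (card {i. i < N \<and> occurs_at w ?s i}) / real N) \<longlonglongrightarrow> L0"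
    unfolding convergent_def word_freq_alt by blast
  have "\<exists>L. (\<lambda>N. real (card {i. i < N \<and> ?P i}) / real N) \<longlonglongrightarrow> L"
  proof (cases "w = replicate (length w) 0")
    case True
    then have "?P = (\<lambda>i. \<not> occurs_at w ?s i)" unfolding departs_from_zeros_def by blast
    then show ?thesis using card_complement_frequency[OF L0] by auto
  next
    case False
    then have "?P = occurs_at w ?s" unfolding departs_from_zeros_def by blast
    then show ?thesis using L0 by auto
  qed
  then obtain L where L: "(\<lambda>N. real (card {i. i < N \<and> ?P i}) / real N) \<longlonglongrightarrow> L" by blast
  have "1 \<le> 1 - L"
  proof (rule run_frequency_le_limit[OF card_complement_frequency[OF L] R, of 1 1 "length w"])
    fix j
    obtain N where N: "N \<ge> j" "\<And>i. i < N div R \<Longrightarrow> (beta_map \<beta> ^^ (N + i)) x \<in> {0..<1 / \<beta>}"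
      using zeros_run[of j] unfolding block_runs_def[OF \<beta>] by auto
    have zero: "?s (N + i) = 0" if "i < N div R" for i
      using N(2)[OF that] \<beta> by (simp add: beta_expansion_def field_simps floor_eq_iff)
    let ?m = "N div R - length w"
    have "{N..<N + ?m} \<subseteq> {i. N \<le> i \<and> i < N + N div R \<and> \<not> ?P i}"
    proof
      fix i assume i: "i \<in> {N..<N + ?m}"
      have "?s (i + k) = 0" if "k < length w" for k
        using zero[of "i + k - N"] i that by auto
      then show "i \<in> {i. N \<le> i \<and> i < N + N div R \<and> \<not> ?P i}"
        using i not_departs_from_zeros by auto
    qed
    then have "card {N..<N + ?m} \<le> card {i. N \<le> i \<and> i < N + N div R \<and> \<not> ?P i}"
      by (intro card_mono) auto
    then have "real (N div R) - real (length w) \<le> real (card {i. N \<le> i \<and> i < N + N div R \<and> \<not> ?P i})"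
      by simp
    then show "\<exists>N\<ge>j. 1 * real (N div (R * 1) * 1) - real (length w)
        \<le> real (card {i. N \<le> i \<and> i < N + N div (R * 1) * 1 \<and> \<not> ?P i})"
      using N(1) by auto
  qed simp
  moreover have "1 / real q \<le> L"
  proof (rule run_frequency_le_limit[OF L R q, of _ 0])
    fix j
    obtain N where N: "N \<ge> j"
      "\<And>i. i < N div (R * q) \<Longrightarrow> (beta_map \<beta> ^^ (N + i * q)) x \<in> {c..<c + 1 / \<beta> ^ q}"
      using block_run[of j] unfolding block_runs_def[OF \<beta>] by auto
    let ?l = "N div (R * q)"
    have inj: "inj_on (\<lambda>i. N + i * q) {..<?l}" using q by (auto simp: inj_on_def)
    have "(\<lambda>i. N + i * q) ` {..<?l} \<subseteq> {i. N \<le> i \<and> i < N + ?l * q \<and> ?P i}"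
    proof
      fix k assume "k \<in> (\<lambda>i. N + i * q) ` {..<?l}"
      then obtain i where i: "i < ?l" "k = N + i * q" by auto
      have "?P k" using block[OF N(2)[OF i(1)]] i(2) occurs_at_shift[of w \<beta> x k]
        unfolding departs_from_zeros_def by simp
      then show "k \<in> {i. N \<le> i \<and> i < N + ?l * q \<and> ?P i}" using i q by simp
    qed
    then have "card ((\<lambda>i. N + i * q) ` {..<?l}) \<le> card {i. N \<le> i \<and> i < N + ?l * q \<and> ?P i}"
      by (intro card_mono) auto
    then have "real ?l \<le> real (card {i. N \<le> i \<and> i < N + ?l * q \<and> ?P i})"
      by (simp add: card_image[OF inj])
    then show "\<exists>N\<ge>j. 1 / real q * real (N div (R * q) * q) - 0
        \<le> real (card {i. N \<le> i \<and> i < N + N div (R * q) * q \<and> ?P i})"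
      using N(1) q by auto
  qed
  moreover have "1 / real q > 0" using q by simp
  ultimately show False by linarith
qed

section \<open>Non-convergence in all bases\<close>

theorem proposition2:
  fixes \<beta> :: "nat \<Rightarrow> real"
  assumes "\<And>n. n \<ge> 1 \<Longrightarrow> \<beta> n > 1"
  shows "hausdorff_dim {x \<in> {0..1 :: real}.
           \<forall>n\<ge>1. \<forall>w. w \<noteq> [] \<and> occurs_in w (beta_shift (\<beta> n)) \<longrightarrow>
             \<not> convergent (word_freq w (beta_expansion (\<beta> n) x))} = 1"
    (is "hausdorff_dim ?D = 1")
proof (rule hausdorff_dim_eq_1I)
  fix t :: real assume t: "0 < t" "t < 1"
  obtain R :: nat where R: "t / (1 - t) < R" using reals_Archimedean2 by blast
  have "R > 0" using R t by (cases "R = 0") (auto simp: field_simps)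
  then have Rt: "t * (1 + 1 / real R) < 1" using R t by (simp add: field_simps)
  have \<beta>: "\<beta> (Suc n) > 1" for n using assms by simp
  \<comment> \<open>For words that do not occur, an arbitrary full block keeps the sets below ubiquitous.\<close>
  have "\<exists>q c. q > 0 \<and> full_branch (\<beta> (Suc n)) q c \<and>
      (w \<noteq> [] \<and> occurs_in w (beta_shift (\<beta> (Suc n))) \<longrightarrow>
        (\<forall>z\<in>{c..<c + 1 / \<beta> (Suc n) ^ q}. departs_from_zeros w (beta_expansion (\<beta> (Suc n)) z) 0))"
    for n w
    using departing_block_exists[OF \<beta>, of w n] full_branch_zeros[OF \<beta>, of n 1]
    by (metis zero_less_one)
  then obtain q c where qc: "\<And>n w. q n w > 0" "\<And>n w. full_branch (\<beta> (Suc n)) (q n w) (c n w)"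
    "\<And>n w z. w \<noteq> [] \<Longrightarrow> occurs_in w (beta_shift (\<beta> (Suc n))) \<Longrightarrow>
      z \<in> {c n w..<c n w + 1 / \<beta> (Suc n) ^ q n w} \<Longrightarrow>
      departs_from_zeros w (beta_expansion (\<beta> (Suc n)) z) 0"
    by metis
  \<comment> \<open>The option \<open>None\<close> asks for late zero runs in base \<open>\<beta> (Suc n)\<close>, and \<open>Some w\<close> for late runs of
     the block belonging to \<open>w\<close>.\<close>
  define V :: "nat \<times> nat list option \<times> nat \<Rightarrow> real set" where
    "V = (\<lambda>(n, v, j). case v of
        None \<Rightarrow> block_runs (\<beta> (Suc n)) R 1 0 j
      | Some w \<Rightarrow> block_runs (\<beta> (Suc n)) R (q n w) (c n w) j)"
  show "hausdorff_measure t ?D \<noteq> 0"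
  proof (rule hausdorff_measure_ubiquitous_INT[OF t])
    show "ubiquitous t (V k)" for k
      using ubiquitous_block_runs[OF \<beta> t(1) Rt \<open>R > 0\<close>] qc(2) full_branch_zeros[OF \<beta>]
      unfolding V_def by (cases k) (auto split: option.split)
    show "{0..1} \<inter> (\<Inter>k. V k) \<subseteq> ?D"
    proof safe
      fix x n w
      assume x: "x \<in> (\<Inter>k. V k)" and "n \<ge> (1::nat)" and w: "w \<noteq> []" "occurs_in w (beta_shift (\<beta> n))"
        and conv: "convergent (word_freq w (beta_expansion (\<beta> n) x))"
      then obtain n' where n: "n = Suc n'" by (cases n) auto
      have "x \<in> block_runs (\<beta> n) R 1 0 j" for j
        using INT_D[OF x, of "(n', None, j)"] unfolding n V_def by simp
      moreover have "x \<in> block_runs (\<beta> n) R (q n' w) (c n' w) j" for j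
        using INT_D[OF x, of "(n', Some w, j)"] unfolding n V_def by simp
      ultimately have "\<not> convergent (word_freq w (beta_expansion (\<beta> n) x))"
        using qc(3)[of w n'] w \<beta> \<open>R > 0\<close> qc(1) unfolding n
        by (intro not_convergent_word_freq[of "\<beta> (Suc n')" R "q n' w" "c n' w"]) auto
      then show False using conv by contradiction
    qed
  qed
qed auto

end
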